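(* Let $A=P_1-R_1+S_1=P_2-R_2+S_2$ be two double weak splittings of type II of the symmetric nonsingular matrix $A\in\mathbb{R}^{n\times n}$, and for $i=1,2$ let $$\widetilde{\mathbf{W}}_i=\begin{pmatrix}(R_iP_i^{-1})^T & -(S_iP_i^{-1})^T\\ I & 0\end{pmatrix}.$$ If $P_2A^{-1}\ge P_1A^{-1}\ge 0$ and $S_2A^{-1}\le S_1A^{-1}\le 0$, then $\rho(\widetilde{\mathbf{W}}_1)\le\rho(\widetilde{\mathbf{W}}_2)<1$.
   Context: Matrix inequalities are entrywise; $\rho$ is the spectral radius; $I$ is the $n\times n$ identity. For a symmetric nonsingular matrix $A\in\mathbb{R}^{n\times n}$, a decomposition $A=P-R+S$ with $P$ nonsingular is a double weak splitting of type II if $RP^{-1}\ge 0$ and $-SP^{-1}\ge 0$. *)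

theory Defs
  imports "Jordan_Normal_Form.Spectral_Radius"
begin

text \<open>Total version of \<^const>\<open>mat_inverse\<close>; its value is unspecified when the argument
  is not invertible.\<close>

definition mat_inv :: "'a :: field mat \<Rightarrow> 'a mat" where
  "mat_inv M = the (mat_inverse M)"

lemma mat_inv:
  fixes M :: "'a :: field mat"
  assumes "M \<in> carrier_mat n n" and "invertible_mat M"
  shows "mat_inv M \<in> carrier_mat n n" and "M * mat_inv M = 1\<^sub>m n" and "mat_inv M * M = 1\<^sub>m n"
proof -
  obtain B where B: "inverts_mat M B" "inverts_mat B M"
    using assms(2) unfolding invertible_mat_def by blast
  have MB: "M * B = 1\<^sub>m n" and BM: "B * M = 1\<^sub>m (dim_row B)"
    using B assms(1) by (simp_all add: inverts_mat_def)
  have "dim_col B = n"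
    using MB by (metis index_mult_mat(3) index_one_mat(3))
  moreover have "dim_row B = n"
    using BM assms(1) by (metis carrier_matD(2) index_mult_mat(3) index_one_mat(3))
  ultimately have "B \<in> carrier_mat n n" and "B * M = 1\<^sub>m n"
    using BM by (metis carrier_matI)+
  then have "M \<in> Units (ring_mat TYPE('a) n ())"
    unfolding Units_def using assms(1) MB by (simp add: ring_mat_def) blast
  then have "mat_inverse M \<noteq> None"
    using mat_inverse(1)[OF assms(1), where b = "()"] by blast
  then obtain C where C: "mat_inverse M = Some C"
    by blast
  then show "mat_inv M \<in> carrier_mat n n" "M * mat_inv M = 1\<^sub>m n" "mat_inv M * M = 1\<^sub>m n"
    using mat_inverse(2)[OF assms(1) C] by (simp_all add: mat_inv_def)
qed

definition real_spectral_radius :: "real mat \<Rightarrow> real" where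
  "real_spectral_radius M = spectral_radius (map_mat complex_of_real M)"

text \<open>The relation \<open>\<le>\<close> on \<^typ>\<open>real mat\<close> is the entrywise order.\<close>

definition double_weak_splitting_II ::
  "nat \<Rightarrow> real mat \<Rightarrow> real mat \<Rightarrow> real mat \<Rightarrow> real mat \<Rightarrow> bool" where
  "double_weak_splitting_II n A P R S \<longleftrightarrow>
     P \<in> carrier_mat n n \<and> R \<in> carrier_mat n n \<and> S \<in> carrier_mat n n \<and>
     A = P - R + S \<and> invertible_mat P \<and>
     R * mat_inv P \<ge> 0\<^sub>m n n \<and> - (S * mat_inv P) \<ge> 0\<^sub>m n n"

definition W_tilde :: "nat \<Rightarrow> real mat \<Rightarrow> real mat \<Rightarrow> real mat \<Rightarrow> real mat" where
  "W_tilde n P R S =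
     four_block_mat (transpose_mat (R * mat_inv P)) (- transpose_mat (S * mat_inv P))
                    (1\<^sub>m n) (0\<^sub>m n n)"

end

theory Submission
  imports Defs
begin

text \<open>Put \<open>e = (R P\<^sup>-\<^sup>1)\<^sup>T\<close>, \<open>f = - (S P\<^sup>-\<^sup>1)\<^sup>T\<close> and \<open>g = (P A\<^sup>-\<^sup>1)\<^sup>T\<close>; then \<open>A = P - R + S\<close> says that \<open>g\<close>
  is the inverse of \<open>1 - e - f\<close>. Let \<open>t\<close> be the spectral radius of the block matrix.
  The moduli of an eigenvector give \<open>y \<ge> 0\<close>, \<open>y \<noteq> 0\<close> with \<open>t\<^sup>2 y \<le> t e y + f y\<close>. If \<open>t \<ge> 1\<close>, this implies
  \<open>(1 - e - f) y \<le> 0\<close>, and multiplying by \<open>g \<ge> 0\<close> gives \<open>y \<le> 0\<close>, a contradiction.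

  For the comparison, take \<open>0 < t < 1\<close> and \<open>y\<close> from the first splitting and set
  \<open>w\<^sub>i = g\<^sub>i (t e\<^sub>i + f\<^sub>i - t\<^sup>2) y\<close>. Eliminating \<open>e\<^sub>i\<close> yields \<open>w\<^sub>i = (1 - t) (t g\<^sub>i + g\<^sub>i f\<^sub>i) y - t y\<close>, which is
  monotone in \<open>g\<^sub>i\<close> and \<open>g\<^sub>i f\<^sub>i\<close>, so \<open>w\<^sub>2 \<ge> w\<^sub>1 \<ge> 0\<close>. The vector \<open>u = y + w\<^sub>2 / t \<ge> y\<close> then satisfies
  \<open>(t e\<^sub>2 + f\<^sub>2 - t\<^sup>2) u = (1 - t) (1 + f\<^sub>2 / t) w\<^sub>2 \<ge> 0\<close>, so that the second spectral radius is at least \<open>t\<close>.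
  Only subinvariant vectors are used, so no Perron eigenvector is needed.\<close>

section \<open>Entrywise order and nonnegative matrices\<close>

lemma mult_mat_vec_mono:
  fixes M :: "real mat"
  assumes M: "M \<in> carrier_mat m n" "0\<^sub>m m n \<le> M"
    and "x \<in> carrier_vec n" "y \<in> carrier_vec n" "x \<le> y"
  shows "M *\<^sub>v x \<le> M *\<^sub>v y"
  using assms
  by (auto simp: less_eq_vec_def less_eq_mat_def scalar_prod_def intro!: sum_mono mult_left_mono)

lemma mult_mat_vec_nonneg:
  fixes M :: "real mat"
  assumes M: "M \<in> carrier_mat m n" "0\<^sub>m m n \<le> M" and x: "x \<in> carrier_vec n" "0\<^sub>v n \<le> x"
  shows "0\<^sub>v m \<le> M *\<^sub>v x"
proof -
  have "M *\<^sub>v 0\<^sub>v n = 0\<^sub>v m"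
    using M by auto
  then show ?thesis
    using mult_mat_vec_mono[OF M zero_carrier_vec x] by simp
qed

lemma mult_mat_nonneg:
  fixes M N :: "real mat"
  assumes "M \<in> carrier_mat m n" "0\<^sub>m m n \<le> M" "N \<in> carrier_mat n l" "0\<^sub>m n l \<le> N"
  shows "0\<^sub>m m l \<le> M * N"
  using assms by (auto simp: less_eq_mat_def scalar_prod_def intro!: sum_nonneg mult_nonneg_nonneg)

section \<open>Powers of nonnegative matrices and the Collatz--Wielandt bound\<close>

lemma pow_mat_nonneg:
  fixes M :: "real mat"
  assumes M: "M \<in> carrier_mat n n" "0\<^sub>m n n \<le> M"
  shows "0\<^sub>m n n \<le> M ^\<^sub>m k"
proof (induction k)
  case 0
  then show ?case using M by (auto simp: less_eq_mat_def)
next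
  case (Suc k)
  have "M ^\<^sub>m k \<in> carrier_mat n n" using M by simp
  then show ?case using mult_mat_nonneg[OF _ Suc M] by simp
qed

lemma pow_mat_mult_vec_ge:
  fixes M :: "real mat"
  assumes M: "M \<in> carrier_mat n n" "0\<^sub>m n n \<le> M"
    and x: "x \<in> carrier_vec n" and t: "0 \<le> t" and le: "t \<cdot>\<^sub>v x \<le> M *\<^sub>v x"
  shows "t ^ k \<cdot>\<^sub>v x \<le> M ^\<^sub>m k *\<^sub>v x"
proof (induction k)
  case 0
  then show ?case using M x by simp
next
  case (Suc k)
  have Mk: "M ^\<^sub>m k \<in> carrier_mat n n" using M by simp
  note nonneg = pow_mat_nonneg[OF M, of k]
  have "t ^ Suc k \<cdot>\<^sub>v x = t \<cdot>\<^sub>v (t ^ k \<cdot>\<^sub>v x)" by (simp add: smult_smult_assoc)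
  also have "\<dots> \<le> t \<cdot>\<^sub>v (M ^\<^sub>m k *\<^sub>v x)"
    using Suc t by (auto simp: less_eq_vec_def intro!: mult_left_mono)
  also have "\<dots> = M ^\<^sub>m k *\<^sub>v (t \<cdot>\<^sub>v x)"
    using mult_mat_vec[OF Mk x] by simp
  also have "\<dots> \<le> M ^\<^sub>m k *\<^sub>v (M *\<^sub>v x)"
    using mult_mat_vec_mono[OF Mk nonneg _ _ le] M x by simp
  also have "\<dots> = M ^\<^sub>m Suc k *\<^sub>v x"
    using assoc_mult_mat_vec[OF Mk M(1) x] by simp
  finally show ?case .
qed

text \<open>Spectral radius below 1 keeps all powers of \<open>M\<close> uniformly bounded, whereas
  a factor \<open>t > 1\<close> would force \<open>M ^ k x\<close> to grow like \<open>t ^ k\<close>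
  at a positive entry of \<open>x\<close>.\<close>

lemma subinvariant_vec_factor_le_1:
  fixes M :: "real mat"
  assumes M: "M \<in> carrier_mat n n" "0\<^sub>m n n \<le> M"
    and rho: "real_spectral_radius M < 1"
    and x: "x \<in> carrier_vec n" "0\<^sub>v n \<le> x" "x \<noteq> 0\<^sub>v n"
    and t: "0 \<le> t" and le: "t \<cdot>\<^sub>v x \<le> M *\<^sub>v x"
  shows "t \<le> 1"
proof (rule ccontr)
  assume "\<not> t \<le> 1"
  then have t1: "1 < t" by simp
  let ?C = "map_mat complex_of_real M"
  have "?C \<in> carrier_mat n n" using M by simp
  \<comment> \<open>The Jordan normal form provides one bound \<open>c\<close> valid for every
    exponent \<open>k\<close>.\<close>
  from spectral_radius_jnf_norm_bound_less_1_upper_triangular[OF this]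
  obtain c where c: "\<And>k. norm_bound (?C ^\<^sub>m k) c"
    using rho unfolding real_spectral_radius_def by blast
  have pow: "?C ^\<^sub>m k = map_mat complex_of_real (M ^\<^sub>m k)" for k
    using of_real_hom.mat_hom_pow[OF M(1)] by metis
  have c': "(M ^\<^sub>m k) $$ (i, j) \<le> c" if "i < n" "j < n" for i j k
  proof -
    have "norm (map_mat complex_of_real (M ^\<^sub>m k) $$ (i, j)) \<le> c"
      using c[of k] that M unfolding norm_bound_def pow by (auto simp del: index_map_mat(1))
    then show ?thesis using that M by simp
  qed
  obtain i where i: "i < n" "0 < x $ i"
    using x by (metis carrier_vecD eq_vecI index_zero_vec less_eq_vec_def order_le_less)
  define d where "d = (\<Sum>j<n. c * x $ j)"
  have "t ^ k * x $ i \<le> d" for k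
  proof -
    have Mk: "M ^\<^sub>m k \<in> carrier_mat n n" using M by simp
    have "t ^ k * x $ i \<le> (M ^\<^sub>m k *\<^sub>v x) $ i"
      using pow_mat_mult_vec_ge[OF M x(1) t le, of k] i Mk x by (auto simp: less_eq_vec_def)
    also have "\<dots> = (\<Sum>j<n. (M ^\<^sub>m k) $$ (i, j) * x $ j)"
      using i x(1) carrier_matD[OF Mk]
      by (auto simp: scalar_prod_def lessThan_atLeast0 simp del: pow_mat_dim intro!: sum.cong)
    also have "\<dots> \<le> d"
      unfolding d_def using i x c'
      by (auto intro!: sum_mono mult_right_mono simp: less_eq_vec_def)
    finally show ?thesis .
  qed
  moreover obtain k where "d / x $ i < t ^ k"
    using real_arch_pow[OF t1] by blast
  ultimately show False
    using i by (metis divide_less_eq linorder_not_less)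
qed

text \<open>The lower Collatz--Wielandt bound: if it failed, scaling \<open>M\<close> by a number strictly between
  the spectral radius and \<open>t\<close> would give a matrix with bounded powers that expands \<open>x\<close>.\<close>

lemma real_spectral_radius_ge:
  fixes M :: "real mat"
  assumes n: "0 < n" and M: "M \<in> carrier_mat n n" "0\<^sub>m n n \<le> M"
    and x: "x \<in> carrier_vec n" "0\<^sub>v n \<le> x" "x \<noteq> 0\<^sub>v n"
    and le: "t \<cdot>\<^sub>v x \<le> M *\<^sub>v x"
  shows "t \<le> real_spectral_radius M"
proof (rule ccontr)
  let ?r = "real_spectral_radius M"
  let ?C = "map_mat complex_of_real M"
  have C: "?C \<in> carrier_mat n n" using M by simp
  have r0: "0 \<le> ?r"
    using spectral_radius_mem_max(1)[OF C n] by (auto simp: real_spectral_radius_def)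
  assume "\<not> t \<le> ?r"
  then obtain s where s: "?r < s" "s < t" using dense by (metis not_le)
  have s0: "0 < s" using r0 s by simp
  let ?N = "(1 / s) \<cdot>\<^sub>m M"
  let ?D = "map_mat complex_of_real ?N"
  have N: "?N \<in> carrier_mat n n" "0\<^sub>m n n \<le> ?N"
    using M s0 by (auto simp: less_eq_mat_def)
  have D: "?D \<in> carrier_mat n n" using N by simp
  obtain k where k: "k \<in> spectrum ?D" "spectral_radius ?D = norm k"
    using spectral_radius_mem_max(1)[OF D n] by auto
  then obtain v where v: "eigenvector ?D v k"
    by (auto simp: spectrum_def eigenvalue_def)
  have vc: "v \<in> carrier_vec n" using v D by (auto simp: eigenvector_def)
  \<comment> \<open>Undoing the scaling turns an eigenvalue \<open>k\<close> of \<open>?D\<close>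
    into the eigenvalue \<open>s * k\<close> of \<open>?C\<close>, so \<open>s * norm k\<close> is
    at most \<open>?r\<close>, which is below \<open>s\<close>.\<close>
  have CD: "?C = complex_of_real s \<cdot>\<^sub>m ?D" using s0 by (intro eq_matI) auto
  have "?C *\<^sub>v v = complex_of_real s \<cdot>\<^sub>v (?D *\<^sub>v v)"
    unfolding CD using M vc
    by (intro eq_vecI) (auto simp: scalar_prod_def sum_distrib_left mult.assoc intro!: sum.cong)
  also have "\<dots> = (complex_of_real s * k) \<cdot>\<^sub>v v"
    using v by (simp add: eigenvector_def smult_smult_assoc)
  finally have "eigenvector ?C v (complex_of_real s * k)"
    using v M by (auto simp: eigenvector_def)
  then have "norm (complex_of_real s * k) \<le> ?r"
    unfolding real_spectral_radius_def
    by (intro spectral_radius_mem_max(2)[OF C n] imageI) (auto simp: spectrum_def eigenvalue_def)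
  then have "s * norm k \<le> ?r" using s0 by (simp add: norm_mult)
  then have "s * norm k < s * 1" using s(1) by linarith
  then have "norm k < 1" using s0 by (rule mult_left_less_imp_less[OF _ less_imp_le])
  then have "real_spectral_radius ?N < 1"
    using k s0 unfolding real_spectral_radius_def by simp
  moreover have "(t / s) \<cdot>\<^sub>v x \<le> ?N *\<^sub>v x"
    using le M x s0 by (auto simp: less_eq_vec_def divide_right_mono)
  ultimately have "t / s \<le> 1"
    using subinvariant_vec_factor_le_1[OF N _ x, of "t / s"] s s0 by simp
  then show False using s s0 by simp
qed

section \<open>Block companion matrices and their quadratic eigenvalue inequality\<close>

lemma four_block_companion_nonneg:
  fixes e f :: "real mat"
  assumes "e \<in> carrier_mat n n" "0\<^sub>m n n \<le> e" "f \<in> carrier_mat n n" "0\<^sub>m n n \<le> f"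
  shows "0\<^sub>m (n + n) (n + n) \<le> four_block_mat e f (1\<^sub>m n) (0\<^sub>m n n)"
  using assms by (auto simp: less_eq_mat_def)

lemma four_block_companion_mult_vec:
  assumes "e \<in> carrier_mat n n" "f \<in> carrier_mat n n" "x \<in> carrier_vec n" "y \<in> carrier_vec n"
  shows "four_block_mat e f (1\<^sub>m n) (0\<^sub>m n n) *\<^sub>v (x @\<^sub>v y) = (e *\<^sub>v x + f *\<^sub>v y) @\<^sub>v (x :: 'a :: comm_ring_1 vec)"
  using assms by (subst four_block_mat_mult_vec[OF assms(1,2) _ _ assms(3,4)]) auto

text \<open>Linearization: the quadratic inequality for \<open>u\<close> is subinvariance of the
  stacked vector with halves \<open>t u\<close> and \<open>u\<close>, to which the Collatz--Wielandt
  bound applies.\<close>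

lemma companion_spectral_radius_ge:
  fixes e f :: "real mat"
  assumes n: "0 < n"
    and e: "e \<in> carrier_mat n n" "0\<^sub>m n n \<le> e" and f: "f \<in> carrier_mat n n" "0\<^sub>m n n \<le> f"
    and u: "u \<in> carrier_vec n" "0\<^sub>v n \<le> u" "u \<noteq> 0\<^sub>v n" and t: "0 \<le> t"
    and le: "t\<^sup>2 \<cdot>\<^sub>v u \<le> t \<cdot>\<^sub>v (e *\<^sub>v u) + f *\<^sub>v u"
  shows "t \<le> real_spectral_radius (four_block_mat e f (1\<^sub>m n) (0\<^sub>m n n))"
proof (rule real_spectral_radius_ge)
  let ?W = "four_block_mat e f (1\<^sub>m n) (0\<^sub>m n n)"
  let ?x = "(t \<cdot>\<^sub>v u) @\<^sub>v u"
  show "0 < n + n" using n by simp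
  show "?W \<in> carrier_mat (n + n) (n + n)" using e f by auto
  show "0\<^sub>m (n + n) (n + n) \<le> ?W" using four_block_companion_nonneg[OF e f] .
  show "?x \<in> carrier_vec (n + n)" using u by auto
  show "0\<^sub>v (n + n) \<le> ?x" using u t by (auto simp: less_eq_vec_def)
  \<comment> \<open>The first half vanishes when \<open>t = 0\<close>, so a nonzero entry is taken
    from the second half, at offset \<open>n\<close>.\<close>
  obtain i where "i < n" "u $ i \<noteq> 0"
    using u by (metis carrier_vecD eq_vecI index_zero_vec)
  then have "?x $ (n + i) \<noteq> 0" using u by simp
  then show "?x \<noteq> 0\<^sub>v (n + n)" using \<open>i < n\<close> by (metis add_strict_left_mono index_zero_vec(1))
  have "?W *\<^sub>v ?x = (t \<cdot>\<^sub>v (e *\<^sub>v u) + f *\<^sub>v u) @\<^sub>v (t \<cdot>\<^sub>v u)"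
    using four_block_companion_mult_vec[OF e(1) f(1) _ u(1)] mult_mat_vec[OF e(1) u(1)] u by simp
  then show "t \<cdot>\<^sub>v ?x \<le> ?W *\<^sub>v ?x"
    using le u e f by (auto simp: less_eq_vec_def power2_eq_square mult.assoc)
qed

lemma smult_append: "k \<cdot>\<^sub>v (x @\<^sub>v z) = (k \<cdot>\<^sub>v x) @\<^sub>v (k \<cdot>\<^sub>v z)"
  by (intro eq_vecI) auto

text \<open>The vector is the entrywise modulus of the second half of a complex eigenvector.\<close>

lemma companion_subinvariant_vec:
  fixes e f :: "real mat"
  assumes n: "0 < n"
    and e: "e \<in> carrier_mat n n" "0\<^sub>m n n \<le> e" and f: "f \<in> carrier_mat n n" "0\<^sub>m n n \<le> f"
    and r: "r = real_spectral_radius (four_block_mat e f (1\<^sub>m n) (0\<^sub>m n n))"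
  obtains y where "0 \<le> r" "y \<in> carrier_vec n" "0\<^sub>v n \<le> y" "y \<noteq> 0\<^sub>v n"
    "r\<^sup>2 \<cdot>\<^sub>v y \<le> r \<cdot>\<^sub>v (e *\<^sub>v y) + f *\<^sub>v y"
proof -
  let ?e = "map_mat complex_of_real e" and ?f = "map_mat complex_of_real f"
  let ?C = "four_block_mat ?e ?f (1\<^sub>m n) (0\<^sub>m n n)"
  have eC: "?e \<in> carrier_mat n n" "?f \<in> carrier_mat n n" using e f by auto
  have C: "?C \<in> carrier_mat (n + n) (n + n)" using eC by auto
  have "map_mat complex_of_real (four_block_mat e f (1\<^sub>m n) (0\<^sub>m n n)) = ?C"
    using e f by (intro eq_matI) auto
  then have "r \<in> norm ` spectrum ?C"
    using spectral_radius_mem_max(1)[OF C] n unfolding r real_spectral_radius_def by auto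
  then obtain k v where k: "r = norm k" and v: "eigenvector ?C v k"
    by (auto simp: spectrum_def eigenvalue_def)
  have vc: "v \<in> carrier_vec (n + n)" and v0: "v \<noteq> 0\<^sub>v (n + n)" and Cv: "?C *\<^sub>v v = k \<cdot>\<^sub>v v"
    using v C by (auto simp: eigenvector_def)
  define z where "z = vec_last v n"
  define x where "x = vec_first v n"
  have v_eq: "v = x @\<^sub>v z" and xc: "x \<in> carrier_vec n" and zc: "z \<in> carrier_vec n"
    using vc by (auto simp: x_def z_def)
  have "(?e *\<^sub>v x + ?f *\<^sub>v z) @\<^sub>v x = (k \<cdot>\<^sub>v x) @\<^sub>v (k \<cdot>\<^sub>v z)"
    using Cv four_block_companion_mult_vec[OF eC xc zc] unfolding v_eq
    by (simp add: smult_append)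
  \<comment> \<open>The lower block row forces \<open>x = k z\<close>; the upper one then becomes
    the quadratic equation for \<open>z\<close>.\<close>
  then have x: "x = k \<cdot>\<^sub>v z" and ex: "?e *\<^sub>v x + ?f *\<^sub>v z = k \<cdot>\<^sub>v x"
    using append_vec_eq[of "?e *\<^sub>v x + ?f *\<^sub>v z" n "k \<cdot>\<^sub>v x" x "k \<cdot>\<^sub>v z"] xc zc eC
    by (auto simp del: map_carrier_mat)
  have z0: "z \<noteq> 0\<^sub>v n"
  proof
    assume "z = 0\<^sub>v n"
    then have "v = 0\<^sub>v (n + n)" unfolding v_eq x by (intro eq_vecI) auto
    with v0 show False by simp
  qed
  define y where "y = map_vec norm z"
  have yc: "y \<in> carrier_vec n" using zc by (simp add: y_def)
  have y0: "y \<noteq> 0\<^sub>v n"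
  proof
    assume "y = 0\<^sub>v n"
    then have "z = 0\<^sub>v n" using zc unfolding y_def
      by (metis carrier_vecD eq_vecI index_map_vec(1) index_zero_vec norm_eq_zero)
    with z0 show False by simp
  qed
  have "r\<^sup>2 * y $ i \<le> r * (row e i \<bullet> y) + row f i \<bullet> y" if i: "i < n" for i
  proof -
    \<comment> \<open>Triangle inequality; the entries of \<open>m\<close> are their own moduli
      because \<open>m\<close> is nonnegative.\<close>
    have abs: "norm ((map_mat complex_of_real m *\<^sub>v z) $ i) \<le> (m *\<^sub>v y) $ i"
      if "m \<in> carrier_mat n n" "0\<^sub>m n n \<le> m" for m
    proof -
      have "norm (complex_of_real (m $$ (i, j)) * z $ j) = m $$ (i, j) * y $ j" if "j < n" for j
        using that i \<open>0\<^sub>m n n \<le> m\<close> \<open>m \<in> _\<close> zc by (auto simp: less_eq_mat_def norm_mult y_def)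
      then have "norm (\<Sum>j<n. complex_of_real (m $$ (i, j)) * z $ j) \<le> (\<Sum>j<n. m $$ (i, j) * y $ j)"
        by (intro order_trans[OF norm_sum]) simp
      then show ?thesis
        using that i zc yc by (simp add: scalar_prod_def lessThan_atLeast0)
    qed
    have "k\<^sup>2 * z $ i = k * (?e *\<^sub>v z) $ i + (?f *\<^sub>v z) $ i"
      using arg_cong[OF ex, of "\<lambda>w. w $ i"] mult_mat_vec[OF eC(1) zc, of k] zc i eC
      unfolding x by (simp add: power2_eq_square)
    then have "r\<^sup>2 * y $ i = norm (k * (?e *\<^sub>v z) $ i + (?f *\<^sub>v z) $ i)"
      using i zc k by (metis carrier_vecD index_map_vec(1) norm_mult norm_power y_def)
    also have "\<dots> \<le> r * norm ((?e *\<^sub>v z) $ i) + norm ((?f *\<^sub>v z) $ i)"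
      by (metis norm_mult norm_triangle_ineq k)
    also have "\<dots> \<le> r * (e *\<^sub>v y) $ i + (f *\<^sub>v y) $ i"
      by (intro add_mono mult_left_mono abs e f) (simp add: k)
    finally show ?thesis using i e f by simp
  qed
  then show thesis
    using that[of y] k yc y0 e f zc by (auto simp: less_eq_vec_def y_def)
qed

section \<open>Convergence and comparison through the inverse of \<open>1 - e - f\<close>\<close>

lemma one_minus_minus_mult_vec:
  fixes e f :: "real mat"
  assumes "e \<in> carrier_mat n n" "f \<in> carrier_mat n n" "y \<in> carrier_vec n"
  shows "(1\<^sub>m n - e - f) *\<^sub>v y = y - e *\<^sub>v y - f *\<^sub>v y"
proof -
  have "1\<^sub>m n - e \<in> carrier_mat n n" using assms by (simp add: minus_carrier_mat)
  then show ?thesis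
    using assms by (simp add: minus_mult_distrib_mat_vec[of _ n n])
qed

lemma companion_spectral_radius_less_1:
  fixes e f g :: "real mat"
  assumes n: "0 < n"
    and e: "e \<in> carrier_mat n n" "0\<^sub>m n n \<le> e" and f: "f \<in> carrier_mat n n" "0\<^sub>m n n \<le> f"
    and g: "g \<in> carrier_mat n n" "0\<^sub>m n n \<le> g" and inv: "g * (1\<^sub>m n - e - f) = 1\<^sub>m n"
  shows "real_spectral_radius (four_block_mat e f (1\<^sub>m n) (0\<^sub>m n n)) < 1" (is "?r < 1")
proof (rule ccontr)
  assume r: "\<not> ?r < 1"
  obtain y where y: "y \<in> carrier_vec n" "0\<^sub>v n \<le> y" "y \<noteq> 0\<^sub>v n"
    and le: "?r\<^sup>2 \<cdot>\<^sub>v y \<le> ?r \<cdot>\<^sub>v (e *\<^sub>v y) + f *\<^sub>v y"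
    using companion_subinvariant_vec[OF n e f refl] .
  let ?d = "y - e *\<^sub>v y - f *\<^sub>v y"
  have d: "?d \<in> carrier_vec n" using y e f by simp
  have "?d \<le> 0\<^sub>v n"
    unfolding less_eq_vec_def
  proof (intro conjI allI impI)
    fix i assume "i < dim_vec (0\<^sub>v n :: real vec)"
    then have i: "i < n" by simp
    have yi: "0 \<le> y $ i" and fi: "0 \<le> (f *\<^sub>v y) $ i"
      using mult_mat_vec_nonneg[OF f y(1,2)] y i f by (auto simp: less_eq_vec_def)
    have "?r * (?r * y $ i) \<le> ?r * (e *\<^sub>v y) $ i + (f *\<^sub>v y) $ i"
      using le i y e f by (auto simp: less_eq_vec_def power2_eq_square mult.assoc)
    \<comment> \<open>Since \<open>?r\<close> is at least 1 and \<open>f y\<close> is nonnegative,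
      \<open>f y\<close> may be enlarged to \<open>?r\<close> times itself, after which one factor
      \<open>?r\<close> cancels.\<close>
    also have "\<dots> \<le> ?r * ((e *\<^sub>v y) $ i + (f *\<^sub>v y) $ i)"
      using r mult_right_mono[OF _ fi, of 1 ?r] by (simp add: distrib_left)
    finally have "?r * y $ i \<le> (e *\<^sub>v y) $ i + (f *\<^sub>v y) $ i"
      using r by (subst (asm) mult_le_cancel_left_pos) auto
    moreover have "1 * y $ i \<le> ?r * y $ i"
      using r yi by (intro mult_right_mono) auto
    ultimately show "?d $ i \<le> 0\<^sub>v n $ i"
      using i y e f by simp
  qed (use f in auto)
  then have "g *\<^sub>v ?d \<le> g *\<^sub>v 0\<^sub>v n"
    using mult_mat_vec_mono[OF g d] by simp
  moreover have "g *\<^sub>v ?d = y"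
    using assoc_mult_mat_vec[OF g(1) _ y(1), of "1\<^sub>m n - e - f"] one_minus_minus_mult_vec[OF e(1) f(1) y(1)]
      inv e f y by (simp add: minus_carrier_mat)
  moreover have "g *\<^sub>v 0\<^sub>v n = 0\<^sub>v n" using g by auto
  ultimately show False using y by (metis order.antisym)
qed

text \<open>The inverse relation gives \<open>g e y = g y - g f y - y\<close>. Substituting it
  removes \<open>e\<close> and leaves only \<open>g\<close> and \<open>g f\<close>, the two products
  that can be compared between splittings.\<close>

lemma companion_residual:
  fixes e f g :: "real mat"
  assumes e: "e \<in> carrier_mat n n" and f: "f \<in> carrier_mat n n" and g: "g \<in> carrier_mat n n"
    and inv: "g * (1\<^sub>m n - e - f) = 1\<^sub>m n" and y: "y \<in> carrier_vec n"
  shows "g *\<^sub>v (t \<cdot>\<^sub>v (e *\<^sub>v y) + f *\<^sub>v y - t\<^sup>2 \<cdot>\<^sub>v y)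
    = (1 - t) \<cdot>\<^sub>v (t \<cdot>\<^sub>v (g *\<^sub>v y) + (g * f) *\<^sub>v y) - t \<cdot>\<^sub>v y" (is "?l = ?r")
proof -
  have "g *\<^sub>v (y - e *\<^sub>v y - f *\<^sub>v y) = y"
    using assoc_mult_mat_vec[OF g _ y, of "1\<^sub>m n - e - f"] one_minus_minus_mult_vec[OF e f y]
      inv e f y by (simp add: minus_carrier_mat)
  moreover have "g *\<^sub>v (y - e *\<^sub>v y - f *\<^sub>v y) = g *\<^sub>v y - g *\<^sub>v (e *\<^sub>v y) - g *\<^sub>v (f *\<^sub>v y)"
    using e f y by (simp add: mult_minus_distrib_mat_vec[OF g])
  ultimately have "g *\<^sub>v y - g *\<^sub>v (e *\<^sub>v y) - g *\<^sub>v (f *\<^sub>v y) = y" by simp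
  then have y_eq: "y $ i = (g *\<^sub>v y) $ i - (g *\<^sub>v (e *\<^sub>v y)) $ i - (g *\<^sub>v (f *\<^sub>v y)) $ i" if "i < n" for i
    using that g y by (metis (no_types) carrier_matD(1) carrier_vecD dim_mult_mat_vec index_minus_vec)
  have l: "?l = t \<cdot>\<^sub>v (g *\<^sub>v (e *\<^sub>v y)) + g *\<^sub>v (f *\<^sub>v y) - t\<^sup>2 \<cdot>\<^sub>v (g *\<^sub>v y)"
    using e f y mult_mat_vec[OF g, of "e *\<^sub>v y" t] mult_mat_vec[OF g y, of "t\<^sup>2"]
    by (simp add: mult_minus_distrib_mat_vec[OF g] mult_add_distrib_mat_vec[OF g])
  have gf: "(g * f) *\<^sub>v y = g *\<^sub>v (f *\<^sub>v y)" using e f g y by simp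
  show ?thesis
  proof (rule eq_vecI)
    fix i assume "i < dim_vec ?r"
    then have i: "i < n" using y by simp
    show "?l $ i = ?r $ i"
      unfolding l gf using i e f g y
      by (simp del: index_mult_mat_vec add: y_eq[OF i] power2_eq_square algebra_simps)
  qed (use g y in auto)
qed

lemma companion_spectral_radius_mono:
  fixes e\<^sub>1 f\<^sub>1 g\<^sub>1 e\<^sub>2 f\<^sub>2 g\<^sub>2 :: "real mat"
  assumes n: "0 < n"
    and e1: "e\<^sub>1 \<in> carrier_mat n n" "0\<^sub>m n n \<le> e\<^sub>1" and f1: "f\<^sub>1 \<in> carrier_mat n n" "0\<^sub>m n n \<le> f\<^sub>1"
    and g1: "g\<^sub>1 \<in> carrier_mat n n" "0\<^sub>m n n \<le> g\<^sub>1" and inv1: "g\<^sub>1 * (1\<^sub>m n - e\<^sub>1 - f\<^sub>1) = 1\<^sub>m n"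
    and e2: "e\<^sub>2 \<in> carrier_mat n n" "0\<^sub>m n n \<le> e\<^sub>2" and f2: "f\<^sub>2 \<in> carrier_mat n n" "0\<^sub>m n n \<le> f\<^sub>2"
    and g2: "g\<^sub>2 \<in> carrier_mat n n" and inv2: "g\<^sub>2 * (1\<^sub>m n - e\<^sub>2 - f\<^sub>2) = 1\<^sub>m n"
      "(1\<^sub>m n - e\<^sub>2 - f\<^sub>2) * g\<^sub>2 = 1\<^sub>m n"
    and g_le: "g\<^sub>1 \<le> g\<^sub>2" and gf_le: "g\<^sub>1 * f\<^sub>1 \<le> g\<^sub>2 * f\<^sub>2"
  shows "real_spectral_radius (four_block_mat e\<^sub>1 f\<^sub>1 (1\<^sub>m n) (0\<^sub>m n n))
    \<le> real_spectral_radius (four_block_mat e\<^sub>2 f\<^sub>2 (1\<^sub>m n) (0\<^sub>m n n))" (is "?t \<le> ?s")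
\<comment> \<open>The case 0 is separated because the test vector \<open>u\<close> below divides by
  \<open>t\<close>; there nonnegativity of \<open>?s\<close> suffices.\<close>
proof (cases "?t = 0")
  case True
  obtain y where "0 \<le> ?s" using companion_subinvariant_vec[OF n e2 f2 refl] .
  then show ?thesis using True by simp
next
  case False
  define t where "t = ?t"
  obtain y where t0: "0 \<le> t" and y: "y \<in> carrier_vec n" "0\<^sub>v n \<le> y" "y \<noteq> 0\<^sub>v n"
    and le: "t\<^sup>2 \<cdot>\<^sub>v y \<le> t \<cdot>\<^sub>v (e\<^sub>1 *\<^sub>v y) + f\<^sub>1 *\<^sub>v y"
    using companion_subinvariant_vec[OF n e1 f1 t_def] .
  have t_pos: "0 < t" using False t0 by (simp add: t_def)
  have t1: "t < 1"
    using companion_spectral_radius_less_1[OF n e1 f1 g1 inv1] by (simp add: t_def)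
  \<comment> \<open>The residual of \<open>y\<close> for the second splitting has no known sign, but
    its image \<open>w\<close> under the second inverse is shown to be nonnegative by comparison
    with the first splitting.\<close>
  define w where "w = g\<^sub>2 *\<^sub>v (t \<cdot>\<^sub>v (e\<^sub>2 *\<^sub>v y) + f\<^sub>2 *\<^sub>v y - t\<^sup>2 \<cdot>\<^sub>v y)"
  have w: "w \<in> carrier_vec n" unfolding w_def using g2 y e2 f2
    by (intro mult_mat_vec_carrier[of _ n n]) auto
  have "0\<^sub>v n \<le> g\<^sub>1 *\<^sub>v (t \<cdot>\<^sub>v (e\<^sub>1 *\<^sub>v y) + f\<^sub>1 *\<^sub>v y - t\<^sup>2 \<cdot>\<^sub>v y)"
    using le y e1 f1 by (intro mult_mat_vec_nonneg[OF g1]) (auto simp: less_eq_vec_def)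
  also have "\<dots> = (1 - t) \<cdot>\<^sub>v (t \<cdot>\<^sub>v (g\<^sub>1 *\<^sub>v y) + (g\<^sub>1 * f\<^sub>1) *\<^sub>v y) - t \<cdot>\<^sub>v y"
    by (rule companion_residual[OF e1(1) f1(1) g1(1) inv1 y(1)])
  also have "\<dots> \<le> (1 - t) \<cdot>\<^sub>v (t \<cdot>\<^sub>v (g\<^sub>2 *\<^sub>v y) + (g\<^sub>2 * f\<^sub>2) *\<^sub>v y) - t \<cdot>\<^sub>v y"
  proof -
    have mono: "(a *\<^sub>v y) $ i \<le> (b *\<^sub>v y) $ i"
      if "a \<in> carrier_mat n n" "b \<in> carrier_mat n n" "a \<le> b" "i < n" for a b i
      using that y by (auto simp: less_eq_mat_def less_eq_vec_def scalar_prod_def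
          intro!: sum_mono mult_right_mono)
    have "g\<^sub>1 * f\<^sub>1 \<in> carrier_mat n n" "g\<^sub>2 * f\<^sub>2 \<in> carrier_mat n n" using g1 f1 g2 f2 by auto
    then show ?thesis
      using mono[OF g1(1) g2 g_le] mono[OF _ _ gf_le] y g1 g2 f1 f2 t0 t1
      by (auto simp: less_eq_vec_def simp del: index_mult_mat_vec assoc_mult_mat_vec
          intro!: mult_left_mono add_mono)
  qed
  also have "\<dots> = w"
    unfolding w_def by (rule companion_residual[OF e2(1) f2(1) g2 inv2(1) y(1), symmetric])
  finally have w0: "0\<^sub>v n \<le> w" .
  \<comment> \<open>Multiplying \<open>w\<close> by \<open>1 - e - f\<close> of the second splitting
    undoes its inverse and recovers the residual of \<open>y\<close>.\<close>
  have d_eq: "w - e\<^sub>2 *\<^sub>v w - f\<^sub>2 *\<^sub>v w = t \<cdot>\<^sub>v (e\<^sub>2 *\<^sub>v y) + f\<^sub>2 *\<^sub>v y - t\<^sup>2 \<cdot>\<^sub>v y" (is "_ = ?d")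
  proof -
    have d: "?d \<in> carrier_vec n" using y e2 f2 by simp
    have "w - e\<^sub>2 *\<^sub>v w - f\<^sub>2 *\<^sub>v w = (1\<^sub>m n - e\<^sub>2 - f\<^sub>2) *\<^sub>v w"
      using one_minus_minus_mult_vec[OF e2(1) f2(1) w] by simp
    also have "\<dots> = ((1\<^sub>m n - e\<^sub>2 - f\<^sub>2) * g\<^sub>2) *\<^sub>v ?d"
      unfolding w_def using assoc_mult_mat_vec[OF _ g2 d, of "1\<^sub>m n - e\<^sub>2 - f\<^sub>2" n] e2 f2 by (simp add: minus_carrier_mat)
    finally show ?thesis using d inv2 by simp
  qed
  have w_eq: "w $ i - (e\<^sub>2 *\<^sub>v w) $ i - (f\<^sub>2 *\<^sub>v w) $ i
      = t * (e\<^sub>2 *\<^sub>v y) $ i + (f\<^sub>2 *\<^sub>v y) $ i - t\<^sup>2 * y $ i" if "i < n" for i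
    using that e2 f2 w y arg_cong[OF d_eq, of "\<lambda>v. v $ i"] by (simp del: index_mult_mat_vec)
  \<comment> \<open>The weight \<open>1 / t\<close> makes the correction contribute exactly
    \<open>e w\<close> to the term \<open>t e u\<close>, which cancels the \<open>- e w\<close> in
    \<open>w_eq\<close>.\<close>
  define u where "u = y + (1 / t) \<cdot>\<^sub>v w"
  have u: "u \<in> carrier_vec n" using y w by (simp add: u_def)
  have y_le_u: "y $ i \<le> u $ i" if "i < n" for i
    using that y w w0 t_pos by (auto simp: u_def less_eq_vec_def)
  have u0: "0\<^sub>v n \<le> u"
    using y y_le_u u by (force simp: less_eq_vec_def)
  have "u \<noteq> 0\<^sub>v n"
    using y y_le_u by (metis carrier_vecD index_zero_vec order.antisym less_eq_vec_def)
  moreover have "t\<^sup>2 \<cdot>\<^sub>v u \<le> t \<cdot>\<^sub>v (e\<^sub>2 *\<^sub>v u) + f\<^sub>2 *\<^sub>v u"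
    unfolding less_eq_vec_def
  proof (intro conjI allI impI)
    fix i assume "i < dim_vec (t \<cdot>\<^sub>v (e\<^sub>2 *\<^sub>v u) + f\<^sub>2 *\<^sub>v u)"
    then have i: "i < n" using f2 by simp
    have "m *\<^sub>v u = m *\<^sub>v y + (1 / t) \<cdot>\<^sub>v (m *\<^sub>v w)" if "m \<in> carrier_mat n n" for m
      unfolding u_def using mult_add_distrib_mat_vec[OF that y(1), of "(1 / t) \<cdot>\<^sub>v w"]
        mult_mat_vec[OF that w] w by simp
    then have mu: "(m *\<^sub>v u) $ i = (m *\<^sub>v y) $ i + (m *\<^sub>v w) $ i / t" if "m \<in> carrier_mat n n" for m
      using that i by (simp del: index_mult_mat_vec)
    have "0 \<le> w $ i" "0 \<le> (f\<^sub>2 *\<^sub>v w) $ i"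
      using mult_mat_vec_nonneg[OF f2 w w0] w0 i f2 w by (auto simp: less_eq_vec_def)
    \<comment> \<open>This is the residual of \<open>u\<close> after that cancellation; both
      coefficients are nonnegative because \<open>0 < t < 1\<close>.\<close>
    then have "0 \<le> (1 - t) * w $ i + (1 / t - 1) * (f\<^sub>2 *\<^sub>v w) $ i"
      using t_pos t1 by simp
    also have "\<dots> = t * (e\<^sub>2 *\<^sub>v u) $ i + (f\<^sub>2 *\<^sub>v u) $ i - t\<^sup>2 * u $ i"
    proof -
      have "t * (e\<^sub>2 *\<^sub>v u) $ i = t * (e\<^sub>2 *\<^sub>v y) $ i + (e\<^sub>2 *\<^sub>v w) $ i"
        "t\<^sup>2 * u $ i = t\<^sup>2 * y $ i + t * w $ i"
        using mu[OF e2(1)] t_pos i y w by (simp_all add: u_def distrib_left power2_eq_square)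
      then show ?thesis
        using w_eq[OF i] mu[OF f2(1)] by (simp add: left_diff_distrib)
    qed
    finally show "(t\<^sup>2 \<cdot>\<^sub>v u) $ i \<le> (t \<cdot>\<^sub>v (e\<^sub>2 *\<^sub>v u) + f\<^sub>2 *\<^sub>v u) $ i"
      using i u e2 f2 by simp
  qed (use u f2 in auto)
  ultimately show ?thesis
    using companion_spectral_radius_ge[OF n e2 f2 u u0 _ t0] by (simp add: t_def)
qed

section \<open>From splittings to companion data\<close>

lemma mat_le_transpose: "transpose_mat M \<le> transpose_mat N \<longleftrightarrow> M \<le> (N :: real mat)"
  by (auto simp: less_eq_mat_def)

text \<open>Multiplying \<open>A = P - R + S\<close> on the right by the inverse of \<open>P\<close>
  and transposing gives \<open>1 - e - f\<close>, and \<open>P\<close> times the inverse of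
  \<open>A\<close> inverts the untransposed product. In \<open>g f\<close> the inner factors
  \<open>P\<close> cancel, which turns conditions on \<open>S\<close> times the inverse of
  \<open>A\<close> into conditions on \<open>g f\<close>.\<close>

lemma double_weak_splitting_II_transposed:
  assumes A: "A \<in> carrier_mat n n" "invertible_mat A" and split: "double_weak_splitting_II n A P R S"
  defines "e \<equiv> transpose_mat (R * mat_inv P)" and "f \<equiv> - transpose_mat (S * mat_inv P)"
    and "g \<equiv> transpose_mat (P * mat_inv A)"
  shows "e \<in> carrier_mat n n" "0\<^sub>m n n \<le> e" "f \<in> carrier_mat n n" "0\<^sub>m n n \<le> f" "g \<in> carrier_mat n n"
    "g * (1\<^sub>m n - e - f) = 1\<^sub>m n" "(1\<^sub>m n - e - f) * g = 1\<^sub>m n"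
    "g * f = - transpose_mat (S * mat_inv A)"
proof -
  have P: "P \<in> carrier_mat n n" and R: "R \<in> carrier_mat n n" and S: "S \<in> carrier_mat n n"
    and A_eq: "A = P - R + S" and P_inv: "invertible_mat P"
    and nonneg: "0\<^sub>m n n \<le> R * mat_inv P" "0\<^sub>m n n \<le> - (S * mat_inv P)"
    using split by (auto simp: double_weak_splitting_II_def)
  let ?Q = "mat_inv P" and ?B = "mat_inv A"
  note Q = mat_inv[OF P P_inv] and B = mat_inv[OF A]
  show e: "e \<in> carrier_mat n n" and f: "f \<in> carrier_mat n n" and g: "g \<in> carrier_mat n n"
    using P R S Q(1) B(1) by (simp_all add: e_def f_def g_def)
  show "0\<^sub>m n n \<le> e" "0\<^sub>m n n \<le> f"
    using nonneg R S P Q(1) by (auto simp: e_def f_def less_eq_mat_def)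
  have "A * ?Q = P * ?Q - R * ?Q + S * ?Q"
    unfolding A_eq using P R S Q(1)
    by (simp add: add_mult_distrib_mat[of _ n n] minus_carrier_mat minus_mult_distrib_mat[of _ n n])
  then have AQ: "transpose_mat (A * ?Q) = 1\<^sub>m n - e - f"
    using R S Q by (intro eq_matI) (auto simp: e_def f_def)
  \<comment> \<open>Transposition reverses products, so this order yields the left inverse property
    of \<open>g\<close>, and the opposite order yields the right one.\<close>
  have "(A * ?Q) * (P * ?B) = A * ((?Q * P) * ?B)"
    using A P Q(1) B(1) by (simp add: assoc_mult_mat[of _ n n _ n _ n])
  then have "(A * ?Q) * (P * ?B) = 1\<^sub>m n" using A B Q by simp
  then have "transpose_mat ((A * ?Q) * (P * ?B)) = 1\<^sub>m n" by simp
  then show "g * (1\<^sub>m n - e - f) = 1\<^sub>m n"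
    using transpose_mult[of "A * ?Q" n n "P * ?B" n] A P B(1) Q(1) AQ by (simp add: g_def)
  have "(P * ?B) * (A * ?Q) = P * ((?B * A) * ?Q)"
    using A P Q(1) B(1) by (simp add: assoc_mult_mat[of _ n n _ n _ n])
  then have "(P * ?B) * (A * ?Q) = 1\<^sub>m n" using A P B Q by simp
  then have "transpose_mat ((P * ?B) * (A * ?Q)) = 1\<^sub>m n" by simp
  then show "(1\<^sub>m n - e - f) * g = 1\<^sub>m n"
    using transpose_mult[of "P * ?B" n n "A * ?Q" n] A P B(1) Q(1) AQ by (simp add: g_def)
  have "(S * ?Q) * (P * ?B) = S * ((?Q * P) * ?B)"
    using S P Q(1) B(1) by (simp add: assoc_mult_mat[of _ n n _ n _ n])
  then have "(S * ?Q) * (P * ?B) = S * ?B" using B Q by simp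
  then have "transpose_mat (S * ?B) = g * transpose_mat (S * ?Q)"
    using transpose_mult[of "S * ?Q" n n "P * ?B" n] S P B(1) Q(1) by (simp add: g_def)
  then show "g * f = - transpose_mat (S * ?B)"
    using g S Q(1) by (simp add: f_def)
qed

theorem theorem3p13:
  fixes n :: nat and A P\<^sub>1 R\<^sub>1 S\<^sub>1 P\<^sub>2 R\<^sub>2 S\<^sub>2 :: "real mat"
  assumes "n \<ge> 1"
    and "A \<in> carrier_mat n n" and "transpose_mat A = A" and "invertible_mat A"
    and "double_weak_splitting_II n A P\<^sub>1 R\<^sub>1 S\<^sub>1"
    and "double_weak_splitting_II n A P\<^sub>2 R\<^sub>2 S\<^sub>2"
    and "P\<^sub>2 * mat_inv A \<ge> P\<^sub>1 * mat_inv A" and "P\<^sub>1 * mat_inv A \<ge> 0\<^sub>m n n"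
    and "S\<^sub>2 * mat_inv A \<le> S\<^sub>1 * mat_inv A" and "S\<^sub>1 * mat_inv A \<le> 0\<^sub>m n n"
  shows "real_spectral_radius (W_tilde n P\<^sub>1 R\<^sub>1 S\<^sub>1) \<le> real_spectral_radius (W_tilde n P\<^sub>2 R\<^sub>2 S\<^sub>2)
       \<and> real_spectral_radius (W_tilde n P\<^sub>2 R\<^sub>2 S\<^sub>2) < 1"
proof -
  have n: "0 < n" using assms(1) by simp
  note s1 = double_weak_splitting_II_transposed[OF assms(2,4,5)]
  note s2 = double_weak_splitting_II_transposed[OF assms(2,4,6)]
  have g1: "0\<^sub>m n n \<le> transpose_mat (P\<^sub>1 * mat_inv A)"
    using assms(8) mat_le_transpose[of "0\<^sub>m n n"] by simp
  have g_le: "transpose_mat (P\<^sub>1 * mat_inv A) \<le> transpose_mat (P\<^sub>2 * mat_inv A)"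
    using assms(7) by (simp only: mat_le_transpose)
  have g2: "0\<^sub>m n n \<le> transpose_mat (P\<^sub>2 * mat_inv A)" using g1 g_le by (rule order_trans)
  \<comment> \<open>Negation reverses the hypothesis on the \<open>S\<close> terms, which then reads
    as monotonicity of \<open>g f\<close>.\<close>
  have "- transpose_mat (S\<^sub>1 * mat_inv A) \<le> - transpose_mat (S\<^sub>2 * mat_inv A)"
    using assms(9) by (auto simp: less_eq_mat_def)
  then have gf_le: "transpose_mat (P\<^sub>1 * mat_inv A) * - transpose_mat (S\<^sub>1 * mat_inv P\<^sub>1)
      \<le> transpose_mat (P\<^sub>2 * mat_inv A) * - transpose_mat (S\<^sub>2 * mat_inv P\<^sub>2)"
    unfolding s1(8) s2(8) .
  show ?thesis
    unfolding W_tilde_def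
    using companion_spectral_radius_mono[OF n s1(1-5) g1 s1(6) s2(1-7) g_le gf_le]
      companion_spectral_radius_less_1[OF n s2(1-5) g2 s2(6)] by blast
qed

end
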